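(* Let $v_1,\dots,v_m\in\mathbb{R}^r$ and let $[m]=P_1\cup\dots\cup P_p$ be a partition into disjoint nonempty sets. Consider a partition family $\mathcal{C}=\{S\subseteq[m]:|S\cap P_j|=b_j\text{ for every }j=1,\dots,p\}$, where $b_1,\dots,b_p$ are integers with $0\le b_j\le|P_j|$ and $\sum_{j=1}^pb_j=r$. Let $B_i=\sum_{e\in P_i}v_ev_e^\top$ for $i=1,\dots,p$, and let $$(A_1,\dots,A_r)=(\underbrace{B_1,\dots,B_1}_{b_1\text{ times}},\underbrace{B_2,\dots,B_2}_{b_2\text{ times}},\dots,\underbrace{B_p,\dots,B_p}_{b_p\text{ times}})$$ be the resulting $r$-tuple of positive semidefinite $r\times r$ matrices. Then $$D(A_1,A_2,\dots,A_r)=\prod_{i=1}^pb_i!\cdot\sum_{S\in\mathcal{C}}\det(V_SV_S^\top),$$ where $V\in\mathbb{R}^{m\times r}$ is the matrix whose rows are $v_1,\dots,v_m$ and $V_S$ is the submatrix of $V$ consisting of the rows indexed by $S$.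
   Context: $[m]=\{1,\dots,m\}$. For symmetric $A_1,\dots,A_r\in\mathbb{R}^{r\times r}$ the mixed discriminant is $D(A_1,\dots,A_r)=\frac{\partial^r}{\partial z_1\cdots\partial z_r}\det(z_1A_1+\dots+z_rA_r)$. *)

theory Defs
  imports
    "HOL-Analysis.Derivative"
    "Jordan_Normal_Form.Determinant"
    "Jordan_Normal_Form.DL_Submatrix"
    "HOL-Library.Disjoint_Sets"
begin

text \<open>
  Indices start at 0, following the matrix library: the ground set is \<open>{..<m}\<close> and the blocks
  are \<open>P 0, \<dots>, P (p - 1)\<close>.
\<close>

definition partial_derivative :: "nat \<Rightarrow> ((nat \<Rightarrow> real) \<Rightarrow> real) \<Rightarrow> (nat \<Rightarrow> real) \<Rightarrow> real" where
  "partial_derivative k f = (\<lambda>z. deriv (\<lambda>t. f (z(k := t))) (z k))"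

definition matrix_pencil :: "real mat list \<Rightarrow> (nat \<Rightarrow> real) \<Rightarrow> real mat" where
  "matrix_pencil As z = mat (length As) (length As) (\<lambda>(i, j). \<Sum>k<length As. z k * (As ! k) $$ (i, j))"

text \<open>
  The \<open>r\<close>-fold mixed derivative of the determinant, a homogeneous polynomial of degree \<open>r\<close>
  in \<open>r\<close> variables, is a constant function of \<open>z\<close>. It is read off at the origin; the lemma
  \<open>mixed_discriminant_any_point\<close> below shows that every other point gives the same number.
\<close>

definition mixed_discriminant :: "real mat list \<Rightarrow> real" where
  "mixed_discriminant As =
     foldr partial_derivative [0..<length As] (\<lambda>z. det (matrix_pencil As z)) (\<lambda>_. 0)"

definition partition_family :: "nat \<Rightarrow> nat \<Rightarrow> (nat \<Rightarrow> nat set) \<Rightarrow> (nat \<Rightarrow> nat) \<Rightarrow> nat set set" where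
  "partition_family m p P b = {S. S \<subseteq> {..<m} \<and> (\<forall>j<p. card (S \<inter> P j) = b j)}"

definition outer_product :: "real vec \<Rightarrow> real mat" where
  "outer_product x = mat (dim_vec x) (dim_vec x) (\<lambda>(k, l). x $ k * x $ l)"

definition block_matrix :: "nat \<Rightarrow> (nat \<Rightarrow> real vec) \<Rightarrow> nat set \<Rightarrow> real mat" where
  "block_matrix r v Q = mat r r (\<lambda>(k, l). \<Sum>e\<in>Q. outer_product (v e) $$ (k, l))"

definition repeated_blocks :: "nat \<Rightarrow> (nat \<Rightarrow> nat) \<Rightarrow> (nat \<Rightarrow> real mat) \<Rightarrow> real mat list" where
  "repeated_blocks p b B = concat (map (\<lambda>i. replicate (b i) (B i)) [0..<p])"

definition row_submatrix :: "real mat \<Rightarrow> nat set \<Rightarrow> real mat" where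
  "row_submatrix V S = submatrix V S UNIV"


section \<open>The mixed derivative is constant\<close>

inductive homogeneous :: "nat \<Rightarrow> ((nat \<Rightarrow> real) \<Rightarrow> real) \<Rightarrow> bool" where
  zero: "homogeneous d (\<lambda>_. 0)"
| const: "homogeneous 0 (\<lambda>_. c)"
| var: "homogeneous d f \<Longrightarrow> homogeneous (Suc d) (\<lambda>z. z k * f z)"
| add: "homogeneous d f \<Longrightarrow> homogeneous d g \<Longrightarrow> homogeneous d (\<lambda>z. f z + g z)"

lemma homogeneous_0: "homogeneous d f \<Longrightarrow> d = 0 \<Longrightarrow> \<exists>c. f = (\<lambda>_. c)"
  by (induction rule: homogeneous.induct) auto

lemma homogeneous_scale: "homogeneous d f \<Longrightarrow> homogeneous d (\<lambda>z. c * f z)"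
proof (induction rule: homogeneous.induct)
  case (var d f k)
  then show ?case using homogeneous.var[OF var.IH, of k] by (simp add: mult.left_commute)
qed (auto simp: distrib_left intro: homogeneous.intros)

lemma homogeneous_sum:
  "(\<And>x. x \<in> X \<Longrightarrow> homogeneous d (f x)) \<Longrightarrow> homogeneous d (\<lambda>z. \<Sum>x\<in>X. f x z)"
  by (induction X rule: infinite_finite_induct) (auto intro: homogeneous.intros)

lemma homogeneous_mult:
  "homogeneous d f \<Longrightarrow> homogeneous e g \<Longrightarrow> homogeneous (d + e) (\<lambda>z. f z * g z)"
proof (induction rule: homogeneous.induct)
  case (var d f k)
  then show ?case using homogeneous.var[OF var.IH, of k] by (simp add: mult.assoc)
qed (auto simp: distrib_right homogeneous_scale intro: homogeneous.intros)

lemma homogeneous_prod: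
  "finite X \<Longrightarrow> (\<And>x. x \<in> X \<Longrightarrow> homogeneous 1 (f x)) \<Longrightarrow> homogeneous (card X) (\<lambda>z. \<Prod>x\<in>X. f x z)"
proof (induction X rule: finite_induct)
  case (insert x X)
  then show ?case using homogeneous_mult[of 1 "f x" "card X"] by simp
qed (auto intro: homogeneous.intros)

lemma homogeneous_has_derivative:
  "homogeneous d f \<Longrightarrow> \<exists>g. homogeneous (d - 1) g \<and> (d = 0 \<longrightarrow> g = (\<lambda>_. 0)) \<and>
     (\<forall>z. ((\<lambda>t. f (z(k := t))) has_real_derivative g z) (at (z k)))"
proof (induction rule: homogeneous.induct)
  case (var d f j)
  then obtain g where g: "homogeneous (d - 1) g" "d = 0 \<longrightarrow> g = (\<lambda>_. 0)"
    "\<And>z. ((\<lambda>t. f (z(k := t))) has_real_derivative g z) (at (z k))" by blast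
  let ?c = "if j = k then 1 else 0 :: real"
  have "homogeneous d (\<lambda>z. z j * g z)"
    using g(1,2) homogeneous.var[OF g(1), of j] by (cases d) (auto intro: homogeneous.intros)
  then have h: "homogeneous d (\<lambda>z. ?c * f z + z j * g z)"
    by (intro homogeneous.add homogeneous_scale var.hyps)
  have "((\<lambda>t. (z(k := t)) j * f (z(k := t))) has_real_derivative ?c * f z + z j * g z) (at (z k))" for z
  proof -
    have "((\<lambda>t. (z(k := t)) j) has_real_derivative ?c) (at (z k))" by (cases "j = k") auto
    from DERIV_mult[OF this g(3)[of z]] show ?thesis by (simp add: mult.commute)
  qed
  with h show ?case
    by (intro exI[of _ "\<lambda>z. ?c * f z + z j * g z"] conjI allI) (simp_all only: diff_Suc_1 nat.simps simp_thms)
next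
  case (add d f g)
  then obtain f' g' where f': "homogeneous (d - 1) f'" "d = 0 \<longrightarrow> f' = (\<lambda>_. 0)"
      "\<And>z. ((\<lambda>t. f (z(k := t))) has_real_derivative f' z) (at (z k))"
    and g': "homogeneous (d - 1) g'" "d = 0 \<longrightarrow> g' = (\<lambda>_. 0)"
      "\<And>z. ((\<lambda>t. g (z(k := t))) has_real_derivative g' z) (at (z k))" by blast
  show ?case
  proof (intro exI[of _ "\<lambda>z. f' z + g' z"] conjI allI)
    show "homogeneous (d - 1) (\<lambda>z. f' z + g' z)" using f'(1) g'(1) by (rule homogeneous.add)
    show "d = 0 \<longrightarrow> (\<lambda>z. f' z + g' z) = (\<lambda>_. 0)" using f'(2) g'(2) by simp
    show "((\<lambda>t. f (z(k := t)) + g (z(k := t))) has_real_derivative f' z + g' z) (at (z k))" for z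
      using f'(3) g'(3) by (rule DERIV_add)
  qed
qed (auto intro: homogeneous.intros)

lemma homogeneous_partial_derivative:
  assumes "homogeneous d f" shows "homogeneous (d - 1) (partial_derivative k f)"
proof -
  obtain g where g: "homogeneous (d - 1) g"
    "\<And>z. ((\<lambda>t. f (z(k := t))) has_real_derivative g z) (at (z k))"
    using homogeneous_has_derivative[OF assms, of k] by blast
  have "partial_derivative k f = g"
    unfolding partial_derivative_def using DERIV_imp_deriv[OF g(2)] by blast
  with g(1) show ?thesis by simp
qed

lemma homogeneous_foldr_partial_derivative:
  "homogeneous d f \<Longrightarrow> homogeneous (d - length ks) (foldr partial_derivative ks f)"
proof (induction ks)
  case (Cons k ks)
  then show ?case using homogeneous_partial_derivative[of "d - length ks" _ k] by simp
qed simp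

lemma homogeneous_det_matrix_pencil: "homogeneous (length As) (\<lambda>z. det (matrix_pencil As z))"
proof -
  let ?r = "length As"
  let ?e = "\<lambda>p i z. \<Sum>k<?r. z k * (As ! k) $$ (i, p i)"
  have entry: "homogeneous 1 (?e p i)" for p i
    using homogeneous.var[OF homogeneous.const] by (intro homogeneous_sum) simp
  have "homogeneous ?r (\<lambda>z. \<Prod>i\<in>{0..<?r}. ?e p i z)" for p
    using homogeneous_prod[of "{0..<?r}" "?e p"] entry by simp
  then have "homogeneous ?r (\<lambda>z. \<Sum>p | p permutes {0..<?r}. signof p * (\<Prod>i\<in>{0..<?r}. ?e p i z))"
    by (intro homogeneous_sum homogeneous_scale)
  moreover have "det (matrix_pencil As z) =
      (\<Sum>p | p permutes {0..<?r}. signof p * (\<Prod>i\<in>{0..<?r}. ?e p i z))" for z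
    unfolding det_def matrix_pencil_def
    by (auto intro!: sum.cong prod.cong dest: permutes_in_image)
  ultimately show ?thesis by presburger
qed

lemma mixed_discriminant_any_point:
  "foldr partial_derivative [0..<length As] (\<lambda>z. det (matrix_pencil As z)) z = mixed_discriminant As"
proof -
  have "homogeneous 0 (foldr partial_derivative [0..<length As] (\<lambda>z. det (matrix_pencil As z)))"
    using homogeneous_foldr_partial_derivative[OF homogeneous_det_matrix_pencil,
        of As "[0..<length As]"] by simp
  from homogeneous_0[OF this refl] show ?thesis unfolding mixed_discriminant_def by auto
qed


section \<open>The repeated blocks form an \<open>r\<close>-tuple of positive semidefinite matrices\<close>

lemma length_repeated_blocks: "length (repeated_blocks p b B) = (\<Sum>i<p. b i)"
  unfolding repeated_blocks_def
  by (simp add: length_concat o_def interv_sum_list_conv_sum_set_nat lessThan_atLeast0)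

lemma outer_product_index:
  "x \<in> carrier_vec r \<Longrightarrow> k < r \<Longrightarrow> l < r \<Longrightarrow> outer_product x $$ (k, l) = x $ k * x $ l"
  unfolding outer_product_def by auto

lemma block_matrix_symmetric:
  assumes "\<And>e. e \<in> Q \<Longrightarrow> v e \<in> carrier_vec r"
  shows "transpose_mat (block_matrix r v Q) = block_matrix r v Q"
  using assms unfolding block_matrix_def
  by (intro eq_matI) (auto intro!: sum.cong simp: outer_product_index[of _ r] mult.commute)

lemma block_matrix_psd:
  assumes "\<And>e. e \<in> Q \<Longrightarrow> v e \<in> carrier_vec r" and x: "x \<in> carrier_vec r"
  shows "x \<bullet> (block_matrix r v Q *\<^sub>v x) \<ge> 0"
proof -
  have "x \<bullet> (block_matrix r v Q *\<^sub>v x) =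
      (\<Sum>k<r. x $ k * (\<Sum>l<r. (\<Sum>e\<in>Q. v e $ k * v e $ l) * x $ l))"
    using assms unfolding block_matrix_def
    by (auto simp: scalar_prod_def lessThan_atLeast0 outer_product_index[of _ r] intro!: sum.cong)
  also have "\<dots> = (\<Sum>k<r. \<Sum>l<r. \<Sum>e\<in>Q. (x $ k * v e $ k) * (x $ l * v e $ l))"
    by (simp add: sum_distrib_left sum_distrib_right mult_ac)
  also have "\<dots> = (\<Sum>k<r. \<Sum>e\<in>Q. \<Sum>l<r. (x $ k * v e $ k) * (x $ l * v e $ l))"
    by (intro sum.cong refl sum.swap)
  also have "\<dots> = (\<Sum>e\<in>Q. \<Sum>k<r. \<Sum>l<r. (x $ k * v e $ k) * (x $ l * v e $ l))"
    by (rule sum.swap)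
  also have "\<dots> = (\<Sum>e\<in>Q. (\<Sum>k<r. x $ k * v e $ k)\<^sup>2)"
    by (simp add: power2_eq_square sum_product)
  finally show ?thesis by (simp add: sum_nonneg)
qed

end

theory Submission
  imports Defs
begin

text \<open>
  Expanding the determinant of the pencil over the rows, only the monomials in which every variable
  occurs exactly once survive the mixed derivative at the origin. So the mixed discriminant is the sum,
  over permutations \<open>f\<close>, of the determinants that take row \<open>i\<close> from the matrix with index
  \<open>f i\<close>. If the \<open>k\<close>-th matrix is \<open>\<Sum>e\<in>Q k. v e (v e)\<^sup>T\<close>, multilinearity turns this into a sum over
  selections \<open>h\<close> with \<open>h k \<in> Q k\<close>, and the sum over \<open>f\<close> of the terms of \<open>h\<close> is a
  Leibniz expansion: each \<open>h\<close> contributes the square of the determinant with rows \<open>v (h k)\<close>.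
  This vanishes unless \<open>h\<close> is injective, and otherwise depends only on the image \<open>S\<close> of \<open>h\<close>; every
  \<open>S\<close> in the partition family is the image of \<open>\<Prod>i. b i!\<close> selections.
\<close>

section \<open>Mixed derivatives of monomials\<close>

text \<open>The power rule applied termwise. The truncated exponent \<open>a x j - 1\<close> is
  harmless at \<open>a x k = 0\<close>, because the factor \<open>real (a x k)\<close> then
  vanishes. The result is again a sum of monomials over \<open>J\<close>, so the rule can be
  iterated.\<close>

lemma partial_derivative_monomials:
  assumes "finite J" "k \<in> J"
  shows "partial_derivative k (\<lambda>z. \<Sum>x\<in>X. c x * (\<Prod>j\<in>J. z j ^ a x j)) =
    (\<lambda>z. \<Sum>x\<in>X. c x * real (a x k) * (\<Prod>j\<in>J. z j ^ (if j = k then a x j - 1 else a x j)))"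
proof
  fix z :: "nat \<Rightarrow> real"
  let ?q = "\<lambda>x. \<Prod>j\<in>J - {k}. z j ^ a x j"
  have split: "(\<Prod>j\<in>J. (z(k := t)) j ^ a x j) = t ^ a x k * ?q x" for t x
    using assms by (simp add: prod.remove[of J k])
  have split': "(\<Prod>j\<in>J. z j ^ (if j = k then a x j - 1 else a x j)) = z k ^ (a x k - 1) * ?q x" for x
    using assms by (simp add: prod.remove[of J k])
  have "((\<lambda>t. \<Sum>x\<in>X. c x * (t ^ a x k * ?q x)) has_real_derivative
      (\<Sum>x\<in>X. c x * (real (a x k) * z k ^ (a x k - 1) * ?q x))) (at (z k))"
    by (auto intro!: derivative_eq_intros sum.cong)
  then show "partial_derivative k (\<lambda>z. \<Sum>x\<in>X. c x * (\<Prod>j\<in>J. z j ^ a x j)) z =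
      (\<Sum>x\<in>X. c x * real (a x k) * (\<Prod>j\<in>J. z j ^ (if j = k then a x j - 1 else a x j)))"
    unfolding partial_derivative_def split split' by (simp add: DERIV_imp_deriv mult_ac)
qed

text \<open>Distinctness means that every variable is differentiated at most once, so the factor
  produced by \<open>k\<close> is the original exponent \<open>a x k\<close>.\<close>

lemma foldr_partial_derivative_monomials:
  assumes "finite J" "distinct ks" "set ks \<subseteq> J"
  shows "foldr partial_derivative ks (\<lambda>z. \<Sum>x\<in>X. c x * (\<Prod>j\<in>J. z j ^ a x j)) =
    (\<lambda>z. \<Sum>x\<in>X. c x * (\<Prod>k\<in>set ks. real (a x k)) *
       (\<Prod>j\<in>J. z j ^ (if j \<in> set ks then a x j - 1 else a x j)))"
  using assms(2,3)
proof (induction ks)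
  case (Cons k ks)
  have IH: "foldr partial_derivative ks (\<lambda>z. \<Sum>x\<in>X. c x * (\<Prod>j\<in>J. z j ^ a x j)) =
    (\<lambda>z. \<Sum>x\<in>X. c x * (\<Prod>k\<in>set ks. real (a x k)) *
       (\<Prod>j\<in>J. z j ^ (if j \<in> set ks then a x j - 1 else a x j)))"
    using Cons by auto
  have k: "k \<in> J" "k \<notin> set ks" using Cons.prems by auto
  have exponent: "(if j = k then (if j \<in> set ks then a x j - 1 else a x j) - 1
      else if j \<in> set ks then a x j - 1 else a x j) =
      (if j \<in> set (k # ks) then a x j - 1 else a x j)" for x j
    using k(2) by simp
  show ?case
    unfolding foldr.simps comp_apply IH partial_derivative_monomials[OF assms(1) k(1)] exponent
    using k(2) by (simp add: mult_ac)
qed simp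

text \<open>The fibre sizes of \<open>f\<close> are the exponents of the monomial
  \<open>\<Prod>i<n. z (f i)\<close>, and the left side is its full mixed derivative at the origin.
  For injective \<open>f\<close> every fibre is a singleton and every factor is 1, with
  \<open>0 ^ 0 = 1\<close>. Otherwise \<open>f\<close> misses some value, and that variable
  contributes the factor 0.\<close>

lemma prod_fibre_card_eq_of_bool_inj:
  fixes f :: "nat \<Rightarrow> nat"
  assumes f: "f ` {..<n} \<subseteq> {..<n}"
  shows "(\<Prod>k<n. real (card {i \<in> {..<n}. f i = k})) * (\<Prod>k<n. 0 ^ (card {i \<in> {..<n}. f i = k} - 1)) =
    of_bool (inj_on f {..<n})"
proof (cases "inj_on f {..<n}")
  case True
  then have im: "f ` {..<n} = {..<n}" using f by (simp add: endo_inj_surj)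
  have "card {i \<in> {..<n}. f i = k} = 1" if k: "k < n" for k
  proof -
    obtain i where i: "i < n" "f i = k" using k im by (metis imageE lessThan_iff)
    with True have "{i \<in> {..<n}. f i = k} = {i}" by (auto simp: inj_on_def)
    then show ?thesis by simp
  qed
  with True show ?thesis by simp
next
  case False
  then have "f ` {..<n} \<noteq> {..<n}" using eq_card_imp_inj_on[of "{..<n}" f] by auto
  then obtain k where k: "k < n" "k \<notin> f ` {..<n}" using f by blast
  then have "card {i \<in> {..<n}. f i = k} = 0" by auto
  then have "(\<Prod>k<n. real (card {i \<in> {..<n}. f i = k})) = 0" using k(1) by (auto intro!: prod_zero)
  with False show ?thesis by simp
qed

section \<open>Multilinear expansion\<close>

text \<open>Distributing each Leibniz product over the row sums picks one summand \<open>h i\<close>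
  per row. The coefficients do not depend on the column, so they come out of the determinant. The
  lemma serves both the pencil, where \<open>x\<close> is a matrix index, and the block matrices,
  where \<open>x\<close> indexes a vector.\<close>

lemma det_sum_rows:
  fixes c :: "nat \<Rightarrow> 'a \<Rightarrow> 'b :: comm_ring_1"
  assumes "\<And>i. i < n \<Longrightarrow> finite (X i)"
  shows "det (mat n n (\<lambda>(i, j). \<Sum>x\<in>X i. c i x * w i x j)) =
    (\<Sum>h\<in>PiE {..<n} X. (\<Prod>i<n. c i (h i)) * det (mat n n (\<lambda>(i, j). w i (h i) j)))"
proof -
  let ?S = "{p. p permutes {..<n}}"
  have fin: "finite (X i)" if "i \<in> {..<n}" for i using assms that by simp
  have lt: "p i < n" if "p permutes {..<n}" "i < n" for p i
    using permutes_in_image[OF that(1), of i] that(2) by simp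
  have det: "det (mat n n (\<lambda>(i, j). M i j)) = (\<Sum>p\<in>?S. signof p * (\<Prod>i<n. M i (p i)))"
    for M :: "nat \<Rightarrow> nat \<Rightarrow> 'b"
    by (subst det_def'[of _ n]) (auto simp: atLeast0LessThan lt intro!: sum.cong prod.cong)
  have "det (mat n n (\<lambda>(i, j). \<Sum>x\<in>X i. c i x * w i x j)) =
      (\<Sum>p\<in>?S. \<Sum>h\<in>PiE {..<n} X. signof p * (\<Prod>i<n. c i (h i) * w i (h i) (p i)))"
    unfolding det by (simp only: prod_sum_PiE[OF finite_lessThan fin] sum_distrib_left)
  also have "\<dots> = (\<Sum>h\<in>PiE {..<n} X. \<Sum>p\<in>?S. signof p * (\<Prod>i<n. c i (h i) * w i (h i) (p i)))"
    by (rule sum.swap)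
  also have "\<dots> = (\<Sum>h\<in>PiE {..<n} X. (\<Prod>i<n. c i (h i)) * det (mat n n (\<lambda>(i, j). w i (h i) j)))"
    unfolding det by (simp add: prod.distrib sum_distrib_left mult_ac)
  finally show ?thesis .
qed

text \<open>The two index sets differ only by convention: members of \<open>PiE\<close> are
  undefined outside \<open>{..<n}\<close>, permutations are the identity there. The hypothesis on
  \<open>F\<close> says that it ignores these values.\<close>

lemma sum_inj_PiE_eq_sum_permutations:
  fixes F :: "(nat \<Rightarrow> nat) \<Rightarrow> 'a :: comm_monoid_add"
  assumes cong: "\<And>f g. (\<And>i. i < n \<Longrightarrow> f i = g i) \<Longrightarrow> F f = F g"
  shows "(\<Sum>f\<in>{f \<in> {..<n} \<rightarrow>\<^sub>E {..<n}. inj_on f {..<n}}. F f) = (\<Sum>f | f permutes {..<n}. F f)"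
proof (rule sum.reindex_bij_witness[where i = "\<lambda>f. restrict f {..<n}"
      and j = "\<lambda>f i. if i < n then f i else i"])
  fix f assume f: "f \<in> {f \<in> {..<n} \<rightarrow>\<^sub>E {..<n}. inj_on f {..<n}}"
  show "restrict (\<lambda>i. if i < n then f i else i) {..<n} = f"
    using f by (auto simp: PiE_def extensional_def fun_eq_iff)
  have "f ` {..<n} = {..<n}" using f by (intro endo_inj_surj) auto
  then have "bij_betw (\<lambda>i. if i < n then f i else i) {..<n} {..<n}"
    using f by (auto simp: bij_betw_def inj_on_def image_def)
  then have "(\<lambda>i. if i < n then f i else i) permutes {..<n}"
    by (rule bij_imp_permutes) simp
  then show "(\<lambda>i. if i < n then f i else i) \<in> {f. f permutes {..<n}}" by simp
  show "F (\<lambda>i. if i < n then f i else i) = F f" by (rule cong) simp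
next
  fix f assume f: "f \<in> {f. f permutes {..<n}}"
  then show "(\<lambda>i. if i < n then restrict f {..<n} i else i) = f"
    by (auto simp: fun_eq_iff permutes_def)
  show "restrict f {..<n} \<in> {f \<in> {..<n} \<rightarrow>\<^sub>E {..<n}. inj_on f {..<n}}"
    using f permutes_in_image[of f "{..<n}"] by (auto simp: permutes_inj_on inj_on_restrict_eq)
qed

section \<open>The mixed discriminant as a sum of determinants\<close>

lemma mixed_discriminant_eq_sum_permutations:
  assumes n: "length As = n"
  shows "mixed_discriminant As =
    (\<Sum>f | f permutes {..<n}. det (mat n n (\<lambda>(i, j). (As ! f i) $$ (i, j))))"
proof -
  let ?N = "\<lambda>f. det (mat n n (\<lambda>(i, j). (As ! f i) $$ (i, j)))"
  let ?X = "{..<n} \<rightarrow>\<^sub>E {..<n}"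
  let ?a = "\<lambda>f k. card {i \<in> {..<n}. f i = k}"
  have fin: "finite ?X" by (simp add: finite_PiE)
  have monomial: "(\<Prod>i<n. z (f i)) = (\<Prod>k<n. z k ^ ?a f k)" if "f \<in> ?X"
    for f :: "nat \<Rightarrow> nat" and z :: "nat \<Rightarrow> real"
  proof -
    have "f ` {..<n} \<subseteq> {..<n}" using that by auto
    \<comment> \<open>Collecting equal factors: \<open>z k\<close> occurs once for each row in the
      fibre of \<open>f\<close> over \<open>k\<close>.\<close>
    from prod.group[OF _ _ this, of "\<lambda>i. z (f i)"] show ?thesis by simp
  qed
  have pencil: "(\<lambda>z. det (matrix_pencil As z)) = (\<lambda>z. \<Sum>f\<in>?X. ?N f * (\<Prod>k<n. z k ^ ?a f k))"
    unfolding matrix_pencil_def n by (rule ext) (simp add: det_sum_rows monomial mult.commute)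
  have "mixed_discriminant As =
      (\<Sum>f\<in>?X. ?N f * (\<Prod>k<n. real (?a f k)) * (\<Prod>j<n. 0 ^ (?a f j - 1)))"
    unfolding mixed_discriminant_def n pencil
    by (subst foldr_partial_derivative_monomials) (auto simp: atLeast0LessThan)
  also have "\<dots> = (\<Sum>f\<in>?X. ?N f * of_bool (inj_on f {..<n}))"
  proof (intro sum.cong refl)
    fix f assume "f \<in> ?X"
    then have "f ` {..<n} \<subseteq> {..<n}" by auto
    from prod_fibre_card_eq_of_bool_inj[OF this]
    show "?N f * (\<Prod>k<n. real (?a f k)) * (\<Prod>j<n. 0 ^ (?a f j - 1)) =
        ?N f * of_bool (inj_on f {..<n})" by (simp only: mult.assoc)
  qed
  also have "\<dots> = (\<Sum>f\<in>{f \<in> ?X. inj_on f {..<n}}. ?N f)"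
    using fin by (simp add: sum.inter_filter of_bool_def if_distrib cong: if_cong)
  also have "\<dots> = (\<Sum>f | f permutes {..<n}. ?N f)"
    by (rule sum_inj_PiE_eq_sum_permutations) (auto intro!: arg_cong[of _ _ det] cong_mat)
  finally show ?thesis .
qed

text \<open>In the term of \<open>f\<close>, row \<open>i\<close> is the sum over \<open>e\<close>
  in \<open>Q (f i)\<close> of the vectors \<open>v e\<close>, each scaled by its own entry
  \<open>v e $ i\<close>. Relabelling selections along \<open>f\<close> gives an index set
  independent of \<open>f\<close>, so the sums can be swapped. For fixed \<open>h\<close> one
  determinant comes from the rows, and the signed coefficients add up to a second copy of
  it.\<close>

lemma mixed_discriminant_block_matrices:
  assumes len: "length As = n"
    and As: "\<And>k. k < n \<Longrightarrow> As ! k = block_matrix n v (Q k)"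
    and fin: "\<And>k. k < n \<Longrightarrow> finite (Q k)"
    and v: "\<And>k e. k < n \<Longrightarrow> e \<in> Q k \<Longrightarrow> v e \<in> carrier_vec n"
  shows "mixed_discriminant As =
    (\<Sum>h\<in>PiE {..<n} Q. (det (mat n n (\<lambda>(i, j). v (h i) $ j)))\<^sup>2)"
proof -
  let ?M = "\<lambda>h. mat n n (\<lambda>(i, j). v (h i) $ j)"
  let ?S = "{f. f permutes {..<n}}"
  have expand: "det (mat n n (\<lambda>(i, j). (As ! f i) $$ (i, j))) =
      (\<Sum>h\<in>PiE {..<n} Q. (\<Prod>i<n. v (h (f i)) $ i) * (signof f * det (?M h)))"
    if f: "f \<in> ?S" for f
  proof -
    have perm: "f permutes {..<n}" using f by simp
    have lt: "f i < n \<longleftrightarrow> i < n" for i using permutes_in_image[OF perm, of i] by simp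
    have lt': "inv_into UNIV f i < n \<longleftrightarrow> i < n" for i
      using permutes_in_image[OF permutes_inv[OF perm], of i] by simp
    have outer: "outer_product (v e) $$ (i, j) = v e $ i * v e $ j"
      if "i < n" "j < n" "e \<in> Q (f i)" for i j e
      using v[of "f i" e] that by (intro outer_product_index[of _ n]) (simp_all add: lt)
    have "(As ! f i) $$ (i, j) = (\<Sum>e\<in>(Q \<circ> f) i. v e $ i * v e $ j)" if "i < n" "j < n" for i j
    proof -
      have "As ! f i = block_matrix n v (Q (f i))" using that by (simp add: As lt)
      with that show ?thesis unfolding block_matrix_def by (simp add: outer)
    qed
    then have "mat n n (\<lambda>(i, j). (As ! f i) $$ (i, j)) =
        mat n n (\<lambda>(i, j). \<Sum>e\<in>(Q \<circ> f) i. v e $ i * v e $ j)"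
      by (intro cong_mat) simp_all
    moreover have "det (mat n n (\<lambda>(i, j). \<Sum>e\<in>(Q \<circ> f) i. v e $ i * v e $ j)) =
        (\<Sum>h\<in>PiE {..<n} (Q \<circ> f). (\<Prod>i<n. v (h i) $ i) * det (?M h))"
      by (rule det_sum_rows) (simp add: fin lt)
    ultimately have "det (mat n n (\<lambda>(i, j). (As ! f i) $$ (i, j))) =
        (\<Sum>h\<in>PiE {..<n} (Q \<circ> f). (\<Prod>i<n. v (h i) $ i) * det (?M h))"
      by simp
    also have "\<dots> = (\<Sum>h\<in>PiE {..<n} Q. (\<Prod>i<n. v (h (f i)) $ i) * det (?M (h \<circ> f)))"
    \<comment> \<open>Selections for \<open>Q \<circ> f\<close> are the selections for
      \<open>Q\<close> precomposed with \<open>f\<close>. Extensionality survives because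
      \<open>f\<close> and its inverse map the complement of \<open>{..<n}\<close> into
      itself.\<close>
    proof (rule sum.reindex_bij_witness[where i = "\<lambda>h. h \<circ> f" and j = "\<lambda>h. h \<circ> inv_into UNIV f"])
      have inv: "inv_into UNIV f (f i) = i" "f (inv_into UNIV f i) = i" for i
        using perm by (simp_all add: permutes_inverses)
      fix h :: "nat \<Rightarrow> nat"
      show "h \<circ> inv_into UNIV f \<circ> f = h" "h \<circ> f \<circ> inv_into UNIV f = h"
        by (simp_all add: fun_eq_iff inv)
      show "(\<Prod>i<n. v ((h \<circ> inv_into UNIV f) (f i)) $ i) * det (?M (h \<circ> inv_into UNIV f \<circ> f)) =
          (\<Prod>i<n. v (h i) $ i) * det (?M h)" by (simp add: inv)
      show "h \<circ> f \<in> PiE {..<n} (Q \<circ> f)" if h: "h \<in> PiE {..<n} Q"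
      proof (rule PiE_I)
        show "(h \<circ> f) i \<in> (Q \<circ> f) i" if "i \<in> {..<n}" for i
          using PiE_mem[OF h, of "f i"] that by (simp add: lt)
        show "(h \<circ> f) i = undefined" if "i \<notin> {..<n}" for i
          using PiE_arb[OF h, of "f i"] that by (simp add: lt)
      qed
      show "h \<circ> inv_into UNIV f \<in> PiE {..<n} Q" if h: "h \<in> PiE {..<n} (Q \<circ> f)"
      proof (rule PiE_I)
        show "(h \<circ> inv_into UNIV f) i \<in> Q i" if "i \<in> {..<n}" for i
          using PiE_mem[OF h, of "inv_into UNIV f i"] that by (simp add: lt' inv)
        show "(h \<circ> inv_into UNIV f) i = undefined" if "i \<notin> {..<n}" for i
          using PiE_arb[OF h, of "inv_into UNIV f i"] that by (simp add: lt')
      qed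
    qed
    also have "\<dots> = (\<Sum>h\<in>PiE {..<n} Q. (\<Prod>i<n. v (h (f i)) $ i) * (signof f * det (?M h)))"
    proof (intro sum.cong refl arg_cong2[of _ _ _ _ times])
      fix h
      \<comment> \<open>Precomposing with \<open>f\<close> permutes the rows of \<open>?M h\<close>,
        which costs only the sign of \<open>f\<close>.\<close>
      have "?M (h \<circ> f) = mat n n (\<lambda>(i, j). ?M h $$ (f i, j))" by (intro cong_mat) (auto simp: lt)
      moreover have "det \<dots> = signof f * det (?M h)"
        using perm by (intro det_permute_rows) (simp_all add: atLeast0LessThan)
      ultimately show "det (?M (h \<circ> f)) = signof f * det (?M h)" by (rule trans[OF arg_cong])
    qed
    finally show ?thesis .
  qed
  have "mixed_discriminant As =
      (\<Sum>f\<in>?S. \<Sum>h\<in>PiE {..<n} Q. (\<Prod>i<n. v (h (f i)) $ i) * (signof f * det (?M h)))"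
    unfolding mixed_discriminant_eq_sum_permutations[OF len] by (intro sum.cong refl expand) simp
  also have "\<dots> =
      (\<Sum>h\<in>PiE {..<n} Q. \<Sum>f\<in>?S. (\<Prod>i<n. v (h (f i)) $ i) * (signof f * det (?M h)))"
    by (rule sum.swap)
  also have "\<dots> = (\<Sum>h\<in>PiE {..<n} Q. det (?M h) * det (?M h))"
  proof (intro sum.cong refl)
    fix h
    have "det (?M h) = (\<Sum>f\<in>?S. signof f * (\<Prod>i<n. v (h (f i)) $ i))"
    proof -
      have "(\<Prod>i<n. ?M h $$ (f i, i)) = (\<Prod>i<n. v (h (f i)) $ i)" if "f permutes {..<n}" for f
        using permutes_in_image[OF that] by (intro prod.cong) auto
      \<comment> \<open>This is the Leibniz formula with the permutation acting on the row index,
        matching the coefficients \<open>v (h (f i)) $ i\<close>.\<close>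
      then show ?thesis by (subst det_col[of _ n]) (auto simp: atLeast0LessThan intro!: sum.cong)
    qed
    then show "(\<Sum>f\<in>?S. (\<Prod>i<n. v (h (f i)) $ i) * (signof f * det (?M h))) =
        det (?M h) * det (?M h)"
      by (simp add: sum_distrib_right mult_ac)
  qed
  finally show ?thesis by (simp add: power2_eq_square)
qed

section \<open>Grouping row selections by their image\<close>

text \<open>\<open>pick S\<close> enumerates \<open>S\<close> in increasing order, which is how
  \<open>submatrix\<close> numbers the selected rows. Strict monotonicity gives injectivity, and
  counting gives surjectivity.\<close>

lemma bij_betw_pick:
  assumes "finite S"
  shows "bij_betw (pick S) {..<card S} S"
proof -
  have inj: "inj_on (pick S) {..<card S}"
    by (intro linorder_inj_onI) (auto dest: pick_mono[OF disjI1])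
  moreover have "pick S ` {..<card S} \<subseteq> S" by (auto intro: pick_in_set[OF disjI1])
  ultimately have "pick S ` {..<card S} = S"
    using assms by (intro card_subset_eq) (auto simp: card_image)
  with inj show ?thesis by (simp add: bij_betw_def)
qed

text \<open>The submatrix is square because \<open>S\<close> has \<open>n\<close> elements, so its
  Gram determinant is the square of its determinant. Listing its rows in the order of
  \<open>h\<close> instead of increasing order changes only the sign, which squaring
  removes.\<close>

lemma det_gram_row_submatrix:
  fixes v :: "nat \<Rightarrow> real vec"
  assumes v: "\<And>e. e < m \<Longrightarrow> v e \<in> carrier_vec n"
    and S: "S \<subseteq> {..<m}" and h: "bij_betw h {..<n} S"
  shows "det (row_submatrix (mat_of_rows n (map v [0..<m])) S *
      transpose_mat (row_submatrix (mat_of_rows n (map v [0..<m])) S)) =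
    (det (mat n n (\<lambda>(i, j). v (h i) $ j)))\<^sup>2"
proof -
  let ?V = "mat_of_rows n (map v [0..<m])"
  let ?W = "row_submatrix ?V S"
  let ?q = "inv_into {..<n} (pick S)"
  \<comment> \<open>The reordering from increasing order to the order of \<open>h\<close>, extended
    by the identity so that it is a permutation in the sense of \<open>permutes\<close>.\<close>
  define f where "f = (\<lambda>i. if i < n then ?q (h i) else i)"
  have finS: "finite S" using S finite_subset by blast
  have cardS: "card S = n" using bij_betw_same_card[OF h] by simp
  have pick: "bij_betw (pick S) {..<n} S" using bij_betw_pick[OF finS] cardS by simp
  have pickS: "pick S i \<in> S" if "i < n" for i using bij_betw_apply[OF pick] that by simp
  have hS: "h i \<in> S" if "i < n" for i using bij_betw_apply[OF h] that by simp
  have rows: "{i. i < dim_row ?V \<and> i \<in> S} = S" using S by auto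
  have W: "?W = mat n n (\<lambda>(i, j). v (pick S i) $ j)"
  proof (rule eq_matI)
    show "dim_row ?W = dim_row (mat n n (\<lambda>(i, j). v (pick S i) $ j))"
      unfolding row_submatrix_def dim_submatrix rows by (simp add: cardS)
    show "dim_col ?W = dim_col (mat n n (\<lambda>(i, j). v (pick S i) $ j))"
      unfolding row_submatrix_def dim_submatrix by simp
    fix i j assume "i < dim_row (mat n n (\<lambda>(i, j). v (pick S i) $ j))"
      "j < dim_col (mat n n (\<lambda>(i, j). v (pick S i) $ j))"
    then have ij: "i < n" "j < n" by simp_all
    then have "pick S i < m" using pickS S by blast
    have "?W $$ (i, j) = ?V $$ (pick S i, pick UNIV j)"
      unfolding row_submatrix_def by (rule submatrix_index) (simp_all only: rows, simp_all add: ij cardS)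
    with ij \<open>pick S i < m\<close> v[of "pick S i"] show "?W $$ (i, j) = mat n n (\<lambda>(i, j). v (pick S i) $ j) $$ (i, j)"
      by (simp add: pick_UNIV mat_of_rows_index)
  qed
  have "bij_betw (?q \<circ> h) {..<n} {..<n}"
    by (rule bij_betw_trans[OF h bij_betw_inv_into[OF pick]])
  then have "bij_betw f {..<n} {..<n}"
    by (rule bij_betw_cong[THEN iffD1, rotated]) (simp add: f_def)
  then have f: "f permutes {..<n}" by (rule bij_imp_permutes) (simp add: f_def)
  have pick_f: "f i < n" "pick S (f i) = h i" if "i < n" for i
    using that bij_betw_inv_into_right[OF pick hS] bij_betw_apply[OF bij_betw_inv_into[OF pick] hS]
    by (simp_all add: f_def)
  have "mat n n (\<lambda>(i, j). v (h i) $ j) = mat n n (\<lambda>(i, j). ?W $$ (f i, j))"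
    unfolding W by (intro cong_mat) (simp_all add: pick_f)
  moreover have "det \<dots> = signof f * det ?W"
    using f by (intro det_permute_rows) (simp_all add: W atLeast0LessThan)
  ultimately have "det (mat n n (\<lambda>(i, j). v (h i) $ j)) = signof f * det ?W" by (rule trans[OF arg_cong])
  then have "(det (mat n n (\<lambda>(i, j). v (h i) $ j)))\<^sup>2 = (det ?W)\<^sup>2"
    by (cases f rule: sign_cases) (simp_all add: power2_eq_square)
  moreover have "?W \<in> carrier_mat n n" by (simp add: W)
  ultimately show ?thesis
    by (simp add: det_mult[of _ n] det_transpose[of _ n] power2_eq_square)
qed

section \<open>Counting the selections with a given image\<close>

text \<open>Composing with one fixed bijection \<open>e\<close> from \<open>A\<close> to
  \<open>T\<close> turns permutations of \<open>A\<close> into bijections onto \<open>T\<close>, and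
  this correspondence is invertible.\<close>

lemma card_PiE_bij_betw:
  assumes "finite A" "finite T" "card A = card T"
  shows "card {f \<in> A \<rightarrow>\<^sub>E T. bij_betw f A T} = fact (card A)"
proof -
  obtain e where e: "bij_betw e A T" using assms finite_same_card_bij by blast
  let ?q = "inv_into A e"
  have q: "bij_betw ?q T A" by (rule bij_betw_inv_into[OF e])
  have qe: "?q (e x) = x" if "x \<in> A" for x using bij_betw_inv_into_left[OF e that] .
  have eq: "e (?q y) = y" if "y \<in> T" for y using bij_betw_inv_into_right[OF e that] .
  have "bij_betw (\<lambda>p. restrict (e \<circ> p) A) {p. p permutes A} {f \<in> A \<rightarrow>\<^sub>E T. bij_betw f A T}"
  proof (rule bij_betw_byWitness[where f' = "\<lambda>f x. if x \<in> A then ?q (f x) else x"])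
    show "\<forall>p\<in>{p. p permutes A}. (\<lambda>x. if x \<in> A then ?q (restrict (e \<circ> p) A x) else x) = p"
      by (auto simp: fun_eq_iff qe permutes_in_image permutes_not_in)
    show "\<forall>f\<in>{f \<in> A \<rightarrow>\<^sub>E T. bij_betw f A T}. restrict (e \<circ> (\<lambda>x. if x \<in> A then ?q (f x) else x)) A = f"
      by (auto simp: fun_eq_iff eq PiE_iff extensional_def)
    show "(\<lambda>p. restrict (e \<circ> p) A) ` {p. p permutes A} \<subseteq> {f \<in> A \<rightarrow>\<^sub>E T. bij_betw f A T}"
    proof (rule image_subsetI)
      fix p assume "p \<in> {p. p permutes A}"
      then have "bij_betw (e \<circ> p) A T"
        using bij_betw_trans[OF permutes_imp_bij e] by blast
      then have "bij_betw (restrict (e \<circ> p) A) A T"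
        by (rule bij_betw_cong[THEN iffD1, rotated]) simp
      then show "restrict (e \<circ> p) A \<in> {f \<in> A \<rightarrow>\<^sub>E T. bij_betw f A T}"
        using bij_betw_apply by fastforce
    qed
    show "(\<lambda>f x. if x \<in> A then ?q (f x) else x) ` {f \<in> A \<rightarrow>\<^sub>E T. bij_betw f A T} \<subseteq> {p. p permutes A}"
    proof (rule image_subsetI)
      fix f assume "f \<in> {f \<in> A \<rightarrow>\<^sub>E T. bij_betw f A T}"
      then have "bij_betw (?q \<circ> f) A A" using bij_betw_trans[OF _ q] by blast
      then have "bij_betw (\<lambda>x. if x \<in> A then ?q (f x) else x) A A"
        by (rule bij_betw_cong[THEN iffD1, rotated]) simp
      then have "(\<lambda>x. if x \<in> A then ?q (f x) else x) permutes A" by (rule bij_imp_permutes) simp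
      then show "(\<lambda>x. if x \<in> A then ?q (f x) else x) \<in> {p. p permutes A}" by simp
    qed
  qed
  from bij_betw_same_card[OF this] show ?thesis
    using card_permutations[OF refl assms(1)] by simp
qed

text \<open>As the sets \<open>P i\<close> are disjoint, a selection with image \<open>S\<close>
  maps the fibre of \<open>g\<close> over \<open>i\<close> onto \<open>S \<inter> P i\<close>. Such
  a selection is therefore an independent choice of one bijection per fibre, and the counts
  multiply.\<close>

lemma card_fibrewise_bijections:
  fixes g :: "'a \<Rightarrow> 'i" and P :: "'i \<Rightarrow> 'b set"
  assumes N: "finite N" and I: "finite I" and S: "finite S"
    and g: "\<And>k. k \<in> N \<Longrightarrow> g k \<in> I"
    and disj: "disjoint_family_on P I" and cover: "S \<subseteq> (\<Union>i\<in>I. P i)"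
    and card: "\<And>i. i \<in> I \<Longrightarrow> card {k \<in> N. g k = i} = card (S \<inter> P i)"
  shows "card {h \<in> (\<Pi>\<^sub>E k\<in>N. P (g k)). inj_on h N \<and> h ` N = S} = (\<Prod>i\<in>I. fact (card (S \<inter> P i)))"
proof -
  let ?G = "\<lambda>i. {k \<in> N. g k = i}"
  let ?H = "{h \<in> (\<Pi>\<^sub>E k\<in>N. P (g k)). inj_on h N \<and> h ` N = S}"
  let ?T = "\<lambda>i. {f \<in> ?G i \<rightarrow>\<^sub>E S \<inter> P i. bij_betw f (?G i) (S \<inter> P i)}"
  have eqI: "i = j" if "x \<in> P i" "x \<in> P j" "i \<in> I" "j \<in> I" for i j x
    using disj that by (auto simp: disjoint_family_on_def)
  have "bij_betw (\<lambda>h. \<lambda>i\<in>I. restrict h (?G i)) ?H (PiE I ?T)"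
  \<comment> \<open>The inverse glues a family of bijections: position \<open>k\<close> uses the
    member belonging to its own fibre.\<close>
  proof (rule bij_betw_byWitness[where f' = "\<lambda>F. \<lambda>k\<in>N. F (g k) k"])
    show "\<forall>h\<in>?H. (\<lambda>k\<in>N. (\<lambda>i\<in>I. restrict h (?G i)) (g k) k) = h"
      using g by (auto simp: fun_eq_iff PiE_iff extensional_def)
    show "\<forall>F\<in>PiE I ?T. (\<lambda>i\<in>I. restrict (\<lambda>k\<in>N. F (g k) k) (?G i)) = F"
    proof (intro ballI ext)
      fix F i x assume F: "F \<in> PiE I ?T"
      show "(\<lambda>i\<in>I. restrict (\<lambda>k\<in>N. F (g k) k) (?G i)) i x = F i x"
      proof (cases "i \<in> I")
        case True
        then have "F i \<in> extensional (?G i)" using PiE_mem[OF F] by (auto simp: PiE_def)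
        with True show ?thesis by (auto simp: extensional_def)
      qed (simp add: PiE_arb[OF F])
    qed
    show "(\<lambda>h. \<lambda>i\<in>I. restrict h (?G i)) ` ?H \<subseteq> PiE I ?T"
    proof (intro image_subsetI PiE_I)
      fix h i assume h: "h \<in> ?H" and i: "i \<in> I"
      have im: "h ` ?G i = S \<inter> P i"
      proof
        show "h ` ?G i \<subseteq> S \<inter> P i" using h by auto
        show "S \<inter> P i \<subseteq> h ` ?G i"
        proof
          fix x assume x: "x \<in> S \<inter> P i"
          then obtain k where k: "k \<in> N" "x = h k" using h by auto
          then have "x \<in> P (g k)" using h by auto
          \<comment> \<open>The element lies in both \<open>P (g k)\<close> and \<open>P i\<close>,
            so disjointness puts its preimage in the fibre over \<open>i\<close>.\<close>
          with x k g i have "g k = i" by (intro eqI[of x]) auto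
          with k show "x \<in> h ` ?G i" by auto
        qed
      qed
      have "inj_on h (?G i)" using h by (auto intro: inj_on_subset)
      with im have "bij_betw (restrict h (?G i)) (?G i) (S \<inter> P i)"
        by (simp add: bij_betw_def inj_on_restrict_eq)
      moreover have "restrict h (?G i) \<in> ?G i \<rightarrow>\<^sub>E S \<inter> P i"
        unfolding restrict_PiE_iff using im by blast
      ultimately have "restrict h (?G i) \<in> ?T i" by (intro CollectI conjI)
      then show "(\<lambda>i\<in>I. restrict h (?G i)) i \<in> ?T i" by (simp only: restrict_apply'[OF i])
    qed simp
    show "(\<lambda>F. \<lambda>k\<in>N. F (g k) k) ` PiE I ?T \<subseteq> ?H"
    proof (rule image_subsetI)
      fix F assume F: "F \<in> PiE I ?T"
      have bij: "bij_betw (F i) (?G i) (S \<inter> P i)" if "i \<in> I" for i using PiE_mem[OF F that] by simp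
      have mem: "F (g k) k \<in> S \<inter> P (g k)" if "k \<in> N" for k
        using bij_betw_apply[OF bij[OF g[OF that]], of k] that by simp
      have inj: "inj_on (\<lambda>k\<in>N. F (g k) k) N"
      proof (rule inj_onI)
        fix k l assume kl: "k \<in> N" "l \<in> N" "(\<lambda>k\<in>N. F (g k) k) k = (\<lambda>k\<in>N. F (g k) k) l"
        then have eq: "F (g k) k = F (g l) l" by simp
        \<comment> \<open>A common value lies in both blocks, so the positions share a fibre, where
          \<open>F (g k)\<close> is injective.\<close>
        then have "g k = g l" using mem[OF kl(1)] mem[OF kl(2)] g kl by (intro eqI) auto
        with eq kl show "k = l" using bij_betw_imp_inj_on[OF bij[OF g[OF kl(1)]]] by (auto dest: inj_onD)
      qed
      have "S \<subseteq> (\<lambda>k\<in>N. F (g k) k) ` N"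
      proof
        fix x assume "x \<in> S"
        with cover obtain i where i: "i \<in> I" "x \<in> S \<inter> P i" by auto
        then obtain k where "k \<in> ?G i" "x = F i k" using bij_betw_imp_surj_on[OF bij[OF i(1)]] by blast
        then show "x \<in> (\<lambda>k\<in>N. F (g k) k) ` N" by auto
      qed
      then have "(\<lambda>k\<in>N. F (g k) k) ` N = S" using mem by auto
      then show "(\<lambda>k\<in>N. F (g k) k) \<in> ?H" using inj mem by auto
    qed
  qed
  then have "card ?H = card (PiE I ?T)" by (rule bij_betw_same_card)
  also have "\<dots> = (\<Prod>i\<in>I. card (?T i))" by (rule card_PiE[OF I])
  also have "\<dots> = (\<Prod>i\<in>I. fact (card (S \<inter> P i)))"
  proof (intro prod.cong refl)
    fix i assume "i \<in> I"
    then show "card (?T i) = fact (card (S \<inter> P i))"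
      using card_PiE_bij_betw[of "?G i" "S \<inter> P i"] N S card[of i] by simp
  qed
  finally show ?thesis .
qed

text \<open>Here \<open>g\<close> sends a position of the tuple to its block. Grouping the injective
  selections by their image makes the summand constant on each group, and the fibrewise count gives
  every group the same size.\<close>

lemma sum_squared_dets_eq_sum_partition_family:
  fixes v :: "nat \<Rightarrow> real vec"
  assumes v: "\<And>e. e < m \<Longrightarrow> v e \<in> carrier_vec r"
    and cover: "(\<Union>j<p. P j) = {..<m}"
    and disj: "disjoint_family_on P {..<p}"
    and g: "\<And>k. k < r \<Longrightarrow> g k < p"
    and fibre: "\<And>i. i < p \<Longrightarrow> card {k \<in> {..<r}. g k = i} = b i"
  shows "(\<Sum>h\<in>(\<Pi>\<^sub>E k\<in>{..<r}. P (g k)). (det (mat r r (\<lambda>(i, j). v (h i) $ j)))\<^sup>2) =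
    (\<Prod>i<p. fact (b i)) * (\<Sum>S\<in>partition_family m p P b.
       det (row_submatrix (mat_of_rows r (map v [0..<m])) S *
         transpose_mat (row_submatrix (mat_of_rows r (map v [0..<m])) S)))"
proof -
  let ?X = "\<Pi>\<^sub>E k\<in>{..<r}. P (g k)"
  let ?Y = "{h \<in> ?X. inj_on h {..<r}}"
  let ?C = "partition_family m p P b"
  let ?M = "\<lambda>h. mat r r (\<lambda>(i, j). v (h i) $ j)"
  let ?D = "\<lambda>S. det (row_submatrix (mat_of_rows r (map v [0..<m])) S *
         transpose_mat (row_submatrix (mat_of_rows r (map v [0..<m])) S))"
  have P: "P i \<subseteq> {..<m}" if "i < p" for i using cover that by auto
  have finP: "finite (P i)" if "i < p" for i using P[OF that] finite_subset by blast
  have fin: "finite ?X" using g finP by (intro finite_PiE) auto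
  have finC: "finite ?C"
    by (rule finite_subset[of _ "Pow {..<m}"]) (auto simp: partition_family_def)
  have image: "h ` {..<r} \<in> ?C" if h: "h \<in> ?Y" for h
  proof -
    have mem: "h k \<in> P (g k)" if "k < r" for k using h that by auto
    have "card (h ` {..<r} \<inter> P j) = b j" if j: "j < p" for j
    proof -
      \<comment> \<open>By disjointness, the elements of the image in \<open>P j\<close> come
        exactly from the positions assigned to block \<open>j\<close>, of which there are
        \<open>b j\<close>.\<close>
      have "g k = j" if "k < r" "h k \<in> P j" for k
        using disj mem[OF that(1)] that g[OF that(1)] j unfolding disjoint_family_on_def by blast
      then have "h ` {..<r} \<inter> P j = h ` {k \<in> {..<r}. g k = j}" using mem by auto
      moreover have "inj_on h {k \<in> {..<r}. g k = j}" using h by (auto intro: inj_on_subset)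
      ultimately show ?thesis using fibre[OF j] by (simp add: card_image)
    qed
    moreover have "h ` {..<r} \<subseteq> {..<m}" using mem g P by blast
    ultimately show ?thesis by (simp add: partition_family_def)
  qed
  have "(\<Sum>h\<in>?X. (det (?M h))\<^sup>2) = (\<Sum>h\<in>?Y. (det (?M h))\<^sup>2)"
  proof (rule sum.mono_neutral_right[OF fin])
    show "\<forall>h\<in>?X - ?Y. (det (?M h))\<^sup>2 = 0"
    proof
      fix h assume "h \<in> ?X - ?Y"
      then obtain i j where ij: "i < r" "j < r" "i \<noteq> j" "h i = h j" by (auto simp: inj_on_def)
      \<comment> \<open>A repeated selection produces two equal rows.\<close>
      then have "det (?M h) = 0" by (intro det_identical_rows[of _ r i j]) (auto intro!: eq_vecI)
      then show "(det (?M h))\<^sup>2 = 0" by simp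
    qed
  qed auto
  also have "\<dots> = (\<Sum>S\<in>?C. \<Sum>h | h \<in> ?Y \<and> h ` {..<r} = S. (det (?M h))\<^sup>2)"
    using fin image by (intro sum.group[symmetric] finC) auto
  also have "\<dots> = (\<Sum>S\<in>?C. (\<Prod>i<p. fact (b i)) * ?D S)"
  proof (intro sum.cong refl)
    fix S assume S: "S \<in> ?C"
    then have Sm: "S \<subseteq> {..<m}" and card: "\<And>j. j < p \<Longrightarrow> card (S \<inter> P j) = b j"
      by (auto simp: partition_family_def)
    have set: "{h. h \<in> ?Y \<and> h ` {..<r} = S} = {h \<in> ?X. inj_on h {..<r} \<and> h ` {..<r} = S}" by auto
    have "(\<Sum>h | h \<in> ?Y \<and> h ` {..<r} = S. (det (?M h))\<^sup>2) =
        (\<Sum>h | h \<in> ?Y \<and> h ` {..<r} = S. ?D S)"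
      using v Sm by (intro sum.cong refl det_gram_row_submatrix[symmetric]) (auto simp: bij_betw_def)
    also have "\<dots> = real (card {h \<in> ?X. inj_on h {..<r} \<and> h ` {..<r} = S}) * ?D S"
      unfolding set by simp
    also have "card {h \<in> ?X. inj_on h {..<r} \<and> h ` {..<r} = S} = (\<Prod>i<p. fact (card (S \<inter> P i)))"
      using Sm cover disj g card fibre finite_subset[OF Sm]
      by (intro card_fibrewise_bijections) auto
    also have "\<dots> = (\<Prod>i<p. fact (b i))" using card by simp
    finally show "(\<Sum>h | h \<in> ?Y \<and> h ` {..<r} = S. (det (?M h))\<^sup>2) = (\<Prod>i<p. fact (b i)) * ?D S"
      by (simp add: of_nat_prod of_nat_fact)
  qed
  finally show ?thesis by (simp add: sum_distrib_left)
qed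

section \<open>Application to the tuple of repeated blocks\<close>

text \<open>This multiplicity gives the fibre sizes of the map from positions to blocks.\<close>

lemma length_filter_concat_replicate:
  "length (filter (\<lambda>x. x = i) (concat (map (\<lambda>i. replicate (b i) i) [0..<p]))) = (if i < p then b i else 0)"
  by (induction p) (auto simp: less_Suc_eq)

theorem lemma5p2:
  fixes m r p :: nat
    and v :: "nat \<Rightarrow> real vec"
    and P :: "nat \<Rightarrow> nat set"
    and b :: "nat \<Rightarrow> nat"
    and B :: "nat \<Rightarrow> real mat"
    and As :: "real mat list"
    and V :: "real mat"
  assumes "\<And>e. e < m \<Longrightarrow> v e \<in> carrier_vec r"
    and "(\<Union>j<p. P j) = {..<m}"
    and "disjoint_family_on P {..<p}"
    and "\<And>j. j < p \<Longrightarrow> P j \<noteq> {}"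
    and "\<And>j. j < p \<Longrightarrow> b j \<le> card (P j)"
    and "(\<Sum>j<p. b j) = r"
    and "\<And>i. i < p \<Longrightarrow> B i = block_matrix r v (P i)"
    and "As = repeated_blocks p b B"
    and "V = mat_of_rows r (map v [0..<m])"
  shows "mixed_discriminant As =
           (\<Prod>i<p. fact (b i)) *
           (\<Sum>S\<in>partition_family m p P b.
              det (row_submatrix V S * transpose_mat (row_submatrix V S)))"
proof -
  \<comment> \<open>The list of block labels: position \<open>k\<close> of the tuple carries the
    matrix of block \<open>gs ! k\<close>.\<close>
  define gs where "gs = concat (map (\<lambda>i. replicate (b i) i) [0..<p])"
  have As: "As = map B gs"
    unfolding assms(8) gs_def repeated_blocks_def by (simp add: map_concat o_def)
  have len: "length As = r" using length_repeated_blocks[of p b B] assms(6,8) by simp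
  then have len_gs: "length gs = r" using As by simp
  have g: "gs ! k < p" if "k < r" for k
    using nth_mem[of k gs] that len_gs unfolding gs_def by auto
  have P: "P i \<subseteq> {..<m}" if "i < p" for i using assms(2) that by auto
  have fibre: "card {k \<in> {..<r}. gs ! k = i} = b i" if "i < p" for i
    using length_filter_concat_replicate[of i b p] that
    unfolding gs_def[symmetric] length_filter_conv_card len_gs by simp
  have "mixed_discriminant As =
      (\<Sum>h\<in>(\<Pi>\<^sub>E k\<in>{..<r}. P (gs ! k)). (det (mat r r (\<lambda>(i, j). v (h i) $ j)))\<^sup>2)"
  proof (rule mixed_discriminant_block_matrices[OF len])
    fix k assume k: "k < r"
    show "As ! k = block_matrix r v (P (gs ! k))" using k len_gs g by (simp add: As assms(7))
    show "finite (P (gs ! k))" using P[OF g[OF k]] finite_subset by blast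
    show "v e \<in> carrier_vec r" if "e \<in> P (gs ! k)" for e
      using P[OF g[OF k]] that by (intro assms(1)) auto
  qed
  also have "\<dots> = (\<Prod>i<p. fact (b i)) *
      (\<Sum>S\<in>partition_family m p P b. det (row_submatrix V S * transpose_mat (row_submatrix V S)))"
    unfolding assms(9)
    by (rule sum_squared_dets_eq_sum_partition_family) (use assms(1-3) g fibre in auto)
  finally show ?thesis .
qed

end
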